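(* Let $\Omega \subset \mathbb{C}$ be a simply-connected domain and let $T : \Omega \to \mathbb{C}^{n\times n}$ be analytic and regular. Suppose $T(z) = D(z) + E(z)$ where $D, E : \Omega \to \mathbb{C}^{n \times n}$ are analytic and $D(z)$ is diagonal for every $z\in\Omega$, with diagonal entries $d_{jj}(z)$, and write $e_{ij}(z)$ for the entries of $E(z)$. Then for any $0 \le \alpha \le 1$, $$\Lambda(T) \subset \bigcup_{j=1}^n G_j^{\alpha},$$ where $G_j^{\alpha}$ is the $j$th generalized Gershgorin region $$G_j^{\alpha} = \{ z \in \Omega : |d_{jj}(z)| \le r_j(z)^{\alpha} c_j(z)^{1-\alpha} \}$$ and $r_j$ and $c_j$ are the $j$th absolute row and column sums of $E$, i.e. $$r_j(z) = \sum_{k=1}^n |e_{jk}(z)|, \qquad c_j(z) = \sum_{i=1}^n |e_{ij}(z)|.$$ Moreover, suppose that $\mathcal{U}$ is a bounded connected component of the union $\bigcup_{j=1}^n G_j^{\alpha}$ such that $\overline{\mathcal{U}} \subset \Omega$. Then $\mathcal{U}$ contains the same number of eigenvalues of $T$ and of $D$, counting multiplicity; and if $\mathcal{U}$ includes $m$ connected components of the Gershgorin regions, it must contain at least $m$ eigenvalues of $T$, counting multiplicity.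
   Context: An analytic $F:\Omega\to\mathbb{C}^{n\times n}$ is regular if $\det F(z)\not\equiv 0$ on $\Omega$. A point $\lambda\in\Omega$ is an eigenvalue of $F$ if $F(\lambda)$ is singular; its multiplicity is the order of the zero of $\det F(z)$ at $\lambda$. The spectrum $\Lambda(F)$ is the set of all eigenvalues of $F$ in $\Omega$. When eigenvalues in a region are counted, they are always counted with multiplicity. "Connected components of the Gershgorin regions" means connected components of the individual sets $G_j^\alpha$, $j=1,\dots,n$ (components of $G_j^\alpha$ for different $j$ being counted separately). The convention $0^0=1$ is used, so that the bound is $c_j(z)$ for $\alpha=0$ and $r_j(z)$ for $\alpha=1$. *)

theory Defs
  imports "HOL-Complex_Analysis.Complex_Analysis"
begin

definition analytic_matrix_on ::
    "(complex \<Rightarrow> complex ^ 'n ^ 'n) \<Rightarrow> complex set \<Rightarrow> bool" where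
  "analytic_matrix_on F \<Omega> \<longleftrightarrow> (\<forall>i j. (\<lambda>z. F z $ i $ j) analytic_on \<Omega>)"

definition regular_on ::
    "(complex \<Rightarrow> complex ^ 'n ^ 'n) \<Rightarrow> complex set \<Rightarrow> bool" where
  "regular_on F \<Omega> \<longleftrightarrow> (\<exists>z\<in>\<Omega>. det (F z) \<noteq> 0)"

definition spectrum ::
    "complex set \<Rightarrow> (complex \<Rightarrow> complex ^ 'n ^ 'n) \<Rightarrow> complex set" where
  "spectrum \<Omega> F = {z \<in> \<Omega>. \<not> invertible (F z)}"

text \<open>
  The zero order is local, so the domain does not enter. It is meaningful at points of the
  domain of an analytic regular \<open>F\<close>; there it is nonnegative, and \<open>nat\<close> loses nothing.
\<close>

definition eig_mult :: "(complex \<Rightarrow> complex ^ 'n ^ 'n) \<Rightarrow> complex \<Rightarrow> nat" where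
  "eig_mult F z = nat (zorder (\<lambda>w. det (F w)) z)"

text \<open>
  As a \<open>sum\<close> over a set, this is the number of eigenvalues only when there are finitely many
  of them in \<open>U\<close>; statements about it should be accompanied by that finiteness.
\<close>

definition eig_count ::
    "complex set \<Rightarrow> (complex \<Rightarrow> complex ^ 'n ^ 'n) \<Rightarrow> complex set \<Rightarrow> nat" where
  "eig_count \<Omega> F U = (\<Sum>z \<in> spectrum \<Omega> F \<inter> U. eig_mult F z)"

definition abs_row_sum :: "complex ^ 'n ^ 'n \<Rightarrow> 'n \<Rightarrow> real" where
  "abs_row_sum A j = (\<Sum>k\<in>UNIV. cmod (A $ j $ k))"

definition abs_col_sum :: "complex ^ 'n ^ 'n \<Rightarrow> 'n \<Rightarrow> real" where
  "abs_col_sum A j = (\<Sum>i\<in>UNIV. cmod (A $ i $ j))"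

text \<open>Real power with the convention \<open>0^0 = 1\<close>; note that \<open>0 powr 0 = 0\<close> in the library.\<close>

definition rpow :: "real \<Rightarrow> real \<Rightarrow> real" where
  "rpow x a = (if a = 0 then 1 else x powr a)"

definition gersh_region ::
    "complex set \<Rightarrow> (complex \<Rightarrow> complex ^ 'n ^ 'n) \<Rightarrow> (complex \<Rightarrow> complex ^ 'n ^ 'n)
      \<Rightarrow> real \<Rightarrow> 'n \<Rightarrow> complex set" where
  "gersh_region \<Omega> D E \<alpha> j =
    {z \<in> \<Omega>. cmod (D z $ j $ j)
              \<le> rpow (abs_row_sum (E z) j) \<alpha> * rpow (abs_col_sum (E z) j) (1 - \<alpha>)}"

text \<open>
  Components are tagged with their index, so that a set which is a component of two different
  regions is counted once for each of them.
\<close>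

definition gersh_components ::
    "complex set \<Rightarrow> (complex \<Rightarrow> complex ^ 'n ^ 'n) \<Rightarrow> (complex \<Rightarrow> complex ^ 'n ^ 'n)
      \<Rightarrow> real \<Rightarrow> ('n \<times> complex set) set" where
  "gersh_components \<Omega> D E \<alpha> = (SIGMA j:UNIV. components (gersh_region \<Omega> D E \<alpha> j))"

end

theory Submission
  imports Defs
begin

text \<open>
  Outside the regions every diagonal entry strictly dominates the bound \<open>r\<^sub>j\<^sup>\<alpha> c\<^sub>j\<^sup>1\<^sup>-\<^sup>\<alpha>\<close>. By
  Hoelder's inequality this makes \<open>D(z) + t E(z)\<close> nonsingular for all \<open>t \<in> [0, 1]\<close>
  (\<open>diagonal_plus_det_nonzero\<close> and \<open>gersh_bound_scale\<close>). The case \<open>t = 1\<close> is the inclusion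
  of the spectrum in the regions.

  For the count, deform \<open>D\<close> into \<open>T\<close> through \<open>D + t E\<close>. A component \<open>U\<close> as in the theorem is
  compact and has an open neighbourhood \<open>W\<close> whose frontier misses all regions
  (\<open>isolating_neighbourhood\<close>, from the Sura-Bura theorem), so no eigenvalue crosses the frontier
  during the deformation, and the number of zeros of the determinant in \<open>W\<close> is constant
  (\<open>zero_count_homotopy\<close>). Since \<open>W\<close> can have holes and many components, constancy is not
  read off from an integral over its boundary; it follows from Rouche's theorem on small discs
  around the zeros together with connectedness of \<open>[0, 1]\<close>.

  For the lower bound it then suffices to count zeros of \<open>det D = \<Prod>j. d\<^sub>j\<^sub>j\<close> in \<open>U\<close>. Every
  component \<open>C\<close> of a single region that lies in \<open>U\<close> contains a zero of \<open>d\<^sub>j\<^sub>j\<close>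
  (\<open>gersh_component_contains_diagonal_zero\<close>): otherwise \<open>r\<^sub>j\<^sup>\<alpha> c\<^sub>j\<^sup>1\<^sup>-\<^sup>\<alpha> / \<bar>d\<^sub>j\<^sub>j\<bar>\<close>, whose logarithm is
  subharmonic, would be at least 1 on \<open>C\<close> and less than 1 on the frontier of a neighbourhood of
  \<open>C\<close>. The maximum principle in question is proved with holomorphic minorants.
\<close>

section \<open>Nonsingularity of diagonally dominant matrices\<close>

lemma rpow_nonneg: "0 \<le> x \<Longrightarrow> 0 \<le> rpow x a"
  by (simp add: rpow_def)

lemma rpow_mono: "0 \<le> x \<Longrightarrow> x \<le> y \<Longrightarrow> 0 \<le> a \<Longrightarrow> rpow x a \<le> rpow y a"
  by (simp add: rpow_def powr_mono2)

lemma continuous_on_rpow: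
  fixes f :: "'a::topological_space \<Rightarrow> real"
  assumes "continuous_on S f" and "\<And>x. x \<in> S \<Longrightarrow> 0 \<le> f x" and "0 \<le> a"
  shows "continuous_on S (\<lambda>x. rpow (f x) a)"
proof (cases "a = 0")
  case False
  then show ?thesis
    using assms by (auto simp: rpow_def intro!: continuous_on_powr')
qed (simp add: rpow_def)

lemma abs_row_sum_nonneg: "0 \<le> abs_row_sum A j"
  by (simp add: abs_row_sum_def sum_nonneg)

lemma abs_col_sum_nonneg: "0 \<le> abs_col_sum A j"
  by (simp add: abs_col_sum_def sum_nonneg)

text \<open>
  Hoelder's inequality for the factorisation \<open>e = e powr a * e powr b\<close> with conjugate exponents
  \<open>1 / a\<close> and \<open>1 / b\<close>. Writing the second factor as \<open>w powr b\<close> keeps the reciprocal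
  exponents out of the statement and includes the limiting case \<open>a = 0\<close>, an equality.
\<close>

lemma Hoelder_weighted_sum:
  fixes e w :: "'a \<Rightarrow> real"
  assumes fin: "finite I" and e: "\<And>k. k \<in> I \<Longrightarrow> 0 \<le> e k" and w: "\<And>k. k \<in> I \<Longrightarrow> 0 \<le> w k"
    and a: "0 \<le> a" and b: "0 < b" and ab: "a + b = 1"
  shows "(\<Sum>k\<in>I. e k * w k powr b) \<le> rpow (\<Sum>k\<in>I. e k) a * (\<Sum>k\<in>I. e k * w k) powr b"
proof (cases "a = 0")
  case True
  then have b1: "b = 1" using ab by simp
  have 1: "0 \<le> (\<Sum>k\<in>I. e k * w k)" by (intro sum_nonneg mult_nonneg_nonneg e w)
  have "(\<Sum>k\<in>I. e k * w k powr b) = (\<Sum>k\<in>I. e k * w k)"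
    by (rule sum.cong) (auto simp: b1 w)
  then show ?thesis using True b1 1 by (simp add: rpow_def)
next
  case False
  then have a0: "0 < a" using a by simp
  define R S where "R = (\<Sum>k\<in>I. e k)" and "S = (\<Sum>k\<in>I. e k * w k)"
  have S0: "0 \<le> S" unfolding S_def by (intro sum_nonneg mult_nonneg_nonneg e w)
  have R0: "0 \<le> R" unfolding R_def by (intro sum_nonneg e)
  show ?thesis
  proof (cases "S = 0")
    case True
    then have "\<forall>k\<in>I. e k * w k = 0"
      unfolding S_def using fin e w by (subst (asm) sum_nonneg_eq_0_iff) auto
    then have "(\<Sum>k\<in>I. e k * w k powr b) = 0"
      by (intro sum.neutral) auto
    then show ?thesis using R0 by (simp add: rpow_def)
  next
    case False
    with S0 have Sp: "0 < S" by simp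
    have Rp: "0 < R"
    proof (rule ccontr)
      assume "\<not> 0 < R"
      with R0 have "R = 0" by simp
      then have "\<forall>k\<in>I. e k = 0"
        unfolding R_def using fin e by (subst (asm) sum_nonneg_eq_0_iff) auto
      then show False using Sp by (simp add: S_def)
    qed
    \<comment> \<open>Rescaled so that the \<open>e\<close>-weighted mean of the \<open>w k\<close> is 1, each power is at most
      its tangent at 1; the tangent is affine, so summing it only sees that mean.\<close>
    have tangent: "w k powr b \<le> (b * (w k * R / S) + a) * (S / R) powr b" if "k \<in> I" for k
    proof (cases "w k = 0")
      case True
      then show ?thesis using a by simp
    next
      case False
      then have wk: "0 < w k" using w that by force
      have "w k powr b = (w k * R / S) powr b * (S / R) powr b"
        using wk Rp Sp by (simp flip: powr_mult)
      also have "\<dots> \<le> (b * (w k * R / S) + a) * (S / R) powr b"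
        using Youngs_inequality_0[of a b 1 "w k * R / S"] a b ab wk Rp Sp
        by (intro mult_right_mono) (auto simp: add.commute)
      finally show ?thesis .
    qed
    have "(\<Sum>k\<in>I. e k * w k powr b)
        \<le> (\<Sum>k\<in>I. e k * ((b * (w k * R / S) + a) * (S / R) powr b))"
      by (intro sum_mono mult_left_mono tangent e)
    also have "\<dots> = (\<Sum>k\<in>I. (b * R / S * (e k * w k) + a * e k) * (S / R) powr b)"
      by (rule sum.cong) (auto simp: algebra_simps)
    also have "\<dots> = (b * R / S * S + a * R) * (S / R) powr b"
      by (simp add: R_def S_def sum.distrib sum_distrib_left sum_distrib_right distrib_right)
    also have "b * R / S * S + a * R = R"
    proof -
      have "b * R / S * S + a * R = (a + b) * R" using Sp by (simp add: algebra_simps)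
      then show ?thesis by (simp add: ab)
    qed
    also have "R * (S / R) powr b = R powr a * S powr b"
    proof -
      have "R = R powr a * R powr b" using Rp ab by (simp flip: powr_add)
      then show ?thesis
        using Rp Sp by (simp add: powr_divide field_simps)
    qed
    finally show ?thesis using \<open>a \<noteq> 0\<close> by (simp add: rpow_def R_def S_def)
  qed
qed

lemma det_zero_kernel:
  fixes A :: "complex ^ 'n ^ 'n"
  assumes "det A = 0"
  obtains v where "v \<noteq> 0" "A *v v = 0"
  using assms invertible_det_nz[of A] invertible_left_inverse[of A] matrix_left_invertible_ker[of A] by blast

text \<open>
  Ostrowski's criterion. For a null vector \<open>v\<close>, the \<open>j\<close>th equation bounds
  \<open>\<bar>d\<^sub>j v\<^sub>j\<bar>\<close> by \<open>\<Sum>k. \<bar>e\<^sub>j\<^sub>k v\<^sub>k\<bar>\<close>. For \<open>a = 1\<close> this is contradicted at an entry of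
  largest modulus. For \<open>a < 1\<close>, Hoelder's inequality splits off the factor
  \<open>rpow (abs_row_sum E j) a\<close>, which cancels against the hypothesis and leaves
  \<open>c\<^sub>j w\<^sub>j \<le> \<Sum>k. \<bar>e\<^sub>j\<^sub>k\<bar> w\<^sub>k\<close> for \<open>w\<^sub>k = \<bar>v\<^sub>k\<bar> powr (1 / (1 - a))\<close>, strictly where
  \<open>v\<^sub>j \<noteq> 0\<close>. Summed over \<open>j\<close>, both sides are the same number, a contradiction.
\<close>

lemma diagonal_plus_det_nonzero:
  fixes D E :: "complex ^ 'n ^ 'n"
  assumes diag: "\<And>i j. i \<noteq> j \<Longrightarrow> D $ i $ j = 0"
    and a: "0 \<le> a" "a \<le> 1"
    and dom: "\<And>j. rpow (abs_row_sum E j) a * rpow (abs_col_sum E j) (1 - a) < cmod (D $ j $ j)"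
  shows "det (D + E) \<noteq> 0"
proof
  assume "det (D + E) = 0"
  then obtain v where v: "v \<noteq> 0" "(D + E) *v v = 0" by (rule det_zero_kernel)
  have row: "cmod (D $ j $ j) * cmod (v $ j) \<le> (\<Sum>k\<in>UNIV. cmod (E $ j $ k) * cmod (v $ k))" for j
  proof -
    have "(\<Sum>k\<in>UNIV. D $ j $ k * v $ k) = (\<Sum>k\<in>{j}. D $ j $ k * v $ k)"
      by (rule sum.mono_neutral_right) (auto simp: diag)
    moreover have "((D + E) *v v) $ j = 0" using v by simp
    ultimately have "D $ j $ j * v $ j = - (\<Sum>k\<in>UNIV. E $ j $ k * v $ k)"
      by (simp add: matrix_vector_mult_def distrib_right sum.distrib add_eq_0_iff)
    then have "cmod (D $ j $ j) * cmod (v $ j) = cmod (\<Sum>k\<in>UNIV. E $ j $ k * v $ k)"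
      by (metis norm_minus_cancel norm_mult)
    also have "\<dots> \<le> (\<Sum>k\<in>UNIV. cmod (E $ j $ k) * cmod (v $ k))"
      by (rule order_trans[OF norm_sum]) (simp add: norm_mult)
    finally show ?thesis .
  qed
  obtain j0 where j0: "v $ j0 \<noteq> 0" using v(1) by (auto simp: vec_eq_iff)
  show False
  proof (cases "a = 1")
    case True
    obtain m where m: "\<And>k. cmod (v $ k) \<le> cmod (v $ m)"
    proof -
      have "Max (range (\<lambda>k. cmod (v $ k))) \<in> range (\<lambda>k. cmod (v $ k))" by (rule Max_in) auto
      then obtain m where m: "Max (range (\<lambda>k. cmod (v $ k))) = cmod (v $ m)"
        by (rule imageE)
      show thesis
        by (rule that[of m]) (metis m Max_ge finite_imageI finite rangeI)
    qed
    have "0 < cmod (v $ j0)" using j0 by simp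
    also have "\<dots> \<le> cmod (v $ m)" by (rule m)
    finally have vm: "0 < cmod (v $ m)" .
    have "cmod (D $ m $ m) * cmod (v $ m) \<le> (\<Sum>k\<in>UNIV. cmod (E $ m $ k) * cmod (v $ m))"
      by (rule order_trans[OF row]) (intro sum_mono mult_left_mono m, simp)
    then have "cmod (D $ m $ m) * cmod (v $ m) \<le> abs_row_sum E m * cmod (v $ m)"
      by (simp add: abs_row_sum_def sum_distrib_right)
    moreover have "abs_row_sum E m < cmod (D $ m $ m)"
      using dom[of m] True abs_row_sum_nonneg[of E m] by (simp add: rpow_def)
    ultimately show False using vm by simp
  next
    case False
    define b where "b = 1 - a"
    have b: "0 < b" "a + b = 1" using a False by (auto simp: b_def)
    define w where "w k = cmod (v $ k) powr (1 / b)" for k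
    have w0: "0 \<le> w k" for k by (simp add: w_def)
    have wb: "w k powr b = cmod (v $ k)" for k using b by (simp add: w_def powr_powr)
    define S where "S j = (\<Sum>k\<in>UNIV. cmod (E $ j $ k) * w k)" for j
    have S0: "0 \<le> S j" for j unfolding S_def by (intro sum_nonneg mult_nonneg_nonneg w0) simp
    have less: "abs_col_sum E j * w j < S j" if "v $ j \<noteq> 0" for j
    proof -
      let ?r = "rpow (abs_row_sum E j) a" and ?c = "abs_col_sum E j"
      have r0: "0 \<le> ?r" by (intro rpow_nonneg abs_row_sum_nonneg)
      have "?r * (?c * w j) powr b = ?r * rpow ?c b * cmod (v $ j)"
        using b abs_col_sum_nonneg[of E j] w0 wb by (simp add: rpow_def powr_mult)
      also have "\<dots> < cmod (D $ j $ j) * cmod (v $ j)"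
        using that dom[of j] by (simp add: b_def)
      also have "\<dots> \<le> (\<Sum>k\<in>UNIV. cmod (E $ j $ k) * w k powr b)"
        using row[of j] by (simp add: wb)
      also have "\<dots> \<le> ?r * S j powr b"
        unfolding S_def abs_row_sum_def
        by (rule Hoelder_weighted_sum) (use a b w0 in auto)
      finally have "?r * (?c * w j) powr b < ?r * S j powr b" .
      then have "(?c * w j) powr b < S j powr b"
        using r0 by (simp add: mult_less_cancel_left)
      then show ?thesis
        using b S0 powr_mono2[of b "S j" "?c * w j"] by (meson linorder_not_less order_less_imp_le)
    qed
    have le: "abs_col_sum E j * w j \<le> S j" for j
      using less[of j] S0[of j] by (cases "v $ j = 0") (auto simp: w_def)
    have "(\<Sum>j\<in>UNIV. abs_col_sum E j * w j) < (\<Sum>j\<in>UNIV. S j)"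
      by (rule sum_strict_mono_ex1) (use le less[OF j0] in auto)
    also have "\<dots> = (\<Sum>k\<in>UNIV. \<Sum>j\<in>UNIV. cmod (E $ j $ k) * w k)"
      unfolding S_def by (rule sum.swap)
    also have "\<dots> = (\<Sum>j\<in>UNIV. abs_col_sum E j * w j)"
      by (simp add: abs_col_sum_def sum_distrib_right)
    finally show False by simp
  qed
qed

text \<open>
  Both sums scale by \<open>t\<close>, so the regions of \<open>D + t E\<close> lie in those of \<open>D + E\<close>: a homotopy
  that shrinks \<open>E\<close> to \<open>0\<close> never produces an eigenvalue outside the regions.
\<close>

lemma gersh_bound_scale:
  fixes E :: "complex ^ 'n ^ 'n"
  assumes t: "0 \<le> t" "t \<le> 1" and a: "0 \<le> a" "a \<le> 1"
  shows "rpow (abs_row_sum (t *\<^sub>R E) j) a * rpow (abs_col_sum (t *\<^sub>R E) j) (1 - a)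
       \<le> rpow (abs_row_sum E j) a * rpow (abs_col_sum E j) (1 - a)"
proof -
  have "abs_row_sum (t *\<^sub>R E) j = t * abs_row_sum E j" "abs_col_sum (t *\<^sub>R E) j = t * abs_col_sum E j"
    using t by (simp_all add: abs_row_sum_def abs_col_sum_def sum_distrib_left)
  moreover have "t * x \<le> x" if "0 \<le> x" for x :: real using t that by (simp add: mult_left_le_one_le)
  ultimately show ?thesis
    using t a abs_row_sum_nonneg[of E j] abs_col_sum_nonneg[of E j]
    by (intro mult_mono rpow_mono rpow_nonneg) auto
qed

section \<open>Counting zeros along a homotopy\<close>

lemma holomorphic_finite_zeros_compact:
  assumes "f holomorphic_on S" "open S" "connected S" "compact K" "K \<subseteq> S"
    and nz: "z \<in> S" "f z \<noteq> 0"
  shows "finite {z\<in>K. f z = 0}"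
proof (cases "f constant_on S")
  case True
  then have "f x \<noteq> 0" if "x \<in> K" for x
    using nz \<open>K \<subseteq> S\<close> that by (auto simp: constant_on_def)
  then have "{z\<in>K. f z = 0} = {}" by blast
  then show ?thesis by (metis finite.emptyI)
next
  case False
  then show ?thesis using holomorphic_compact_finite_zeros assms by blast
qed

text \<open>
  Inside a circle all winding numbers are 1, so the weighted count of Rouche's theorem
  becomes a count of zeros. The disc of radius \<open>R > r\<close> leaves room for a connected open set
  around the closed disc that contains only finitely many zeros.
\<close>

lemma Rouche_disc:
  assumes rR: "0 < r" "r < R" and f: "f holomorphic_on ball z R" and g: "g holomorphic_on ball z R"
    and close: "\<And>w. w \<in> sphere z r \<Longrightarrow> cmod (g w - f w) < cmod (f w)"
  shows "(\<Sum>p | p \<in> ball z r \<and> g p = 0. zorder g p) = (\<Sum>p | p \<in> ball z r \<and> f p = 0. zorder f p)"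
proof -
  define \<rho> where "\<rho> = (r + R) / 2"
  have \<rho>: "r < \<rho>" "\<rho> < R" using rR by (auto simp: \<rho>_def)
  define B where "B = ball z \<rho>"
  have sub: "B \<subseteq> cball z \<rho>" "cball z \<rho> \<subseteq> ball z R" "sphere z r \<subseteq> B" "cball z r \<subseteq> B"
    using \<rho> by (auto simp: B_def)
  obtain w where w: "w \<in> sphere z r"
    using rR by (metis less_imp_le sphere_eq_empty ex_in_conv not_less)
  have fnz: "f w \<noteq> 0" if "w \<in> sphere z r" for w using close[OF that] by auto
  have gnz: "g w \<noteq> 0" if "w \<in> sphere z r" for w using close[OF that] by auto
  have fin: "finite {p\<in>B. h p = 0}" if "h holomorphic_on ball z R" "h w \<noteq> 0" for h
  proof (rule finite_subset)
    show "finite {p\<in>cball z \<rho>. h p = 0}"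
      by (rule holomorphic_finite_zeros_compact[OF that(1) _ _ _ sub(2) _ that(2)])
        (use w sub \<rho> in auto)
  qed (use sub in auto)
  have finf: "finite {p\<in>B. f p = 0}" and fing: "finite {p\<in>B. g p = 0}"
    using fin f g fnz gnz w by blast+
  have 1: "(\<Sum>p\<in>{p\<in>B. f p + (g p - f p) = 0}. winding_number (circlepath z r) p * zorder (\<lambda>p. f p + (g p - f p)) p)
      = (\<Sum>p\<in>{p\<in>B. f p = 0}. winding_number (circlepath z r) p * zorder f p)"
  proof (rule Rouche_theorem)
    show "f holomorphic_on B" "(\<lambda>p. g p - f p) holomorphic_on B"
      using f g sub by (auto intro!: holomorphic_on_diff intro: holomorphic_on_subset)
    show "\<forall>p. p \<notin> B \<longrightarrow> winding_number (circlepath z r) p = 0"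
    proof (intro allI impI)
      fix p assume "p \<notin> B"
      then show "winding_number (circlepath z r) p = 0"
        using sub rR by (intro winding_number_zero_outside[of _ "cball z r"]) (auto simp: subset_iff)
    qed
  qed (use finf fing rR sub close in \<open>auto simp: B_def\<close>)
  have 2: "(\<Sum>p\<in>{p\<in>B. h p = 0}. winding_number (circlepath z r) p * zorder h p)
      = of_int (\<Sum>p | p \<in> ball z r \<and> h p = 0. zorder h p)"
    if fin: "finite {p\<in>B. h p = 0}" and nz: "\<And>p. p \<in> sphere z r \<Longrightarrow> h p \<noteq> 0" for h
  proof -
    have "(\<Sum>p\<in>{p\<in>B. h p = 0}. winding_number (circlepath z r) p * zorder h p)
        = (\<Sum>p | p \<in> ball z r \<and> h p = 0. winding_number (circlepath z r) p * zorder h p)"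
    proof (rule sum.mono_neutral_right[OF fin])
      show "{p. p \<in> ball z r \<and> h p = 0} \<subseteq> {p \<in> B. h p = 0}" using sub by auto
      show "\<forall>p\<in>{p \<in> B. h p = 0} - {p. p \<in> ball z r \<and> h p = 0}.
          winding_number (circlepath z r) p * of_int (zorder h p) = 0"
      proof
        fix p assume p: "p \<in> {p \<in> B. h p = 0} - {p. p \<in> ball z r \<and> h p = 0}"
        then have "p \<notin> sphere z r" using nz by auto
        with p have "p \<notin> cball z r" by auto
        then have "winding_number (circlepath z r) p = 0"
          using rR by (intro winding_number_zero_outside[of _ "cball z r"]) auto
        then show "winding_number (circlepath z r) p * of_int (zorder h p) = 0" by simp
      qed
    qed
    also have "\<dots> = (\<Sum>p | p \<in> ball z r \<and> h p = 0. of_int (zorder h p))"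
      by (rule sum.cong) (auto simp: winding_number_circlepath dist_norm norm_minus_commute)
    finally show ?thesis by simp
  qed
  have "of_int (\<Sum>p | p \<in> ball z r \<and> g p = 0. zorder g p)
      = (of_int (\<Sum>p | p \<in> ball z r \<and> f p = 0. zorder f p) :: complex)"
    using 1 2[OF finf fnz] 2[OF fing gnz] by simp
  then show ?thesis by (simp only: of_int_eq_iff)
qed

definition zero_count :: "(complex \<Rightarrow> complex) \<Rightarrow> complex set \<Rightarrow> int" where
  "zero_count f W = (\<Sum>p | p \<in> W \<and> f p = 0. zorder f p)"

text \<open>
  The number of zeros in \<open>W\<close> is stable under uniformly small perturbations. The zeros of
  \<open>f\<close> in \<open>W\<close> are enclosed in disjoint small discs. On the compact remainder of
  \<open>closure W\<close>, \<open>\<bar>f\<bar>\<close> has a positive lower bound \<open>\<epsilon>\<close>, so an \<open>\<epsilon>\<close>-close \<open>g\<close> has no zero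
  there, and Rouche's theorem applies to each disc. Working with discs around the zeros makes
  the argument independent of the shape of \<open>W\<close>, which may have holes.
\<close>

lemma zero_count_near:
  assumes \<Omega>: "open \<Omega>" "connected \<Omega>" and W: "open W" "compact (closure W)" "closure W \<subseteq> \<Omega>"
    and f: "f holomorphic_on \<Omega>" and nz: "\<And>z. z \<in> frontier W \<Longrightarrow> f z \<noteq> 0"
    and nontriv: "z0 \<in> \<Omega>" "f z0 \<noteq> 0"
  obtains \<epsilon> where "\<epsilon> > 0"
    "\<And>g. g holomorphic_on \<Omega> \<Longrightarrow> (\<And>z. z \<in> closure W \<Longrightarrow> cmod (g z - f z) < \<epsilon>)
       \<Longrightarrow> zero_count g W = zero_count f W"
proof -
  define Z where "Z = {z\<in>W. f z = 0}"
  have WO: "W \<subseteq> closure W" "W \<subseteq> \<Omega>" using closure_subset W by auto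
  have "finite {z\<in>closure W. f z = 0}"
    by (rule holomorphic_finite_zeros_compact[OF f \<Omega> W(2,3) nontriv])
  then have finZ: "finite Z" by (rule finite_subset[rotated]) (use WO in \<open>auto simp: Z_def\<close>)
  have small: "\<forall>\<^sub>F r in at_right 0. r < b" if "0 < b" for b :: real
    by (rule eventually_mono[OF eventually_at_right_real[OF that]]) simp
  \<comment> \<open>Radius \<open>2 * r\<close> inside \<open>W\<close>: the outer radius for \<open>Rouche_disc\<close>.\<close>
  have "\<forall>z\<in>Z. \<forall>\<^sub>F r in at_right 0. cball z (2 * r) \<subseteq> W"
  proof
    fix z assume "z \<in> Z"
    then obtain e where e: "0 < e" "cball z e \<subseteq> W"
      using W(1) by (auto simp: Z_def open_contains_cball)
    have "\<forall>\<^sub>F r in at_right 0. r < e / 2" using e by (intro small) auto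
    then show "\<forall>\<^sub>F r in at_right 0. cball z (2 * r) \<subseteq> W"
      by eventually_elim (use e in auto)
  qed
  moreover have "\<forall>z\<in>Z. \<forall>\<^sub>F r in at_right 0. \<forall>z'\<in>Z. z \<noteq> z' \<longrightarrow> r < dist z z' / 2"
  proof (intro ballI eventually_ball_finite finZ)
    fix z z' assume "z \<in> Z" "z' \<in> Z"
    show "\<forall>\<^sub>F r in at_right 0. z \<noteq> z' \<longrightarrow> r < dist z z' / 2"
    proof (cases "z = z'")
      case False
      then have "\<forall>\<^sub>F r in at_right 0. r < dist z z' / 2" by (intro small) simp
      then show ?thesis by (rule eventually_mono) simp
    qed simp
  qed
  ultimately have "\<forall>\<^sub>F r in at_right 0. (\<forall>z\<in>Z. cball z (2 * r) \<subseteq> W) \<and>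
      (\<forall>z\<in>Z. \<forall>z'\<in>Z. z \<noteq> z' \<longrightarrow> r < dist z z' / 2)"
    by (intro eventually_conj eventually_ball_finite finZ)
  then have "\<forall>\<^sub>F r in at_right 0. 0 < r \<and> (\<forall>z\<in>Z. cball z (2 * r) \<subseteq> W) \<and>
      (\<forall>z\<in>Z. \<forall>z'\<in>Z. z \<noteq> z' \<longrightarrow> r < dist z z' / 2)"
    using eventually_at_right_less[of "0::real"] by eventually_elim auto
  then obtain r :: real where r: "0 < r" and rW: "\<And>z. z \<in> Z \<Longrightarrow> cball z (2 * r) \<subseteq> W"
    and rd: "\<And>z z'. z \<in> Z \<Longrightarrow> z' \<in> Z \<Longrightarrow> z \<noteq> z' \<Longrightarrow> r < dist z z' / 2"
    using eventually_happens'[OF trivial_limit_at_right_real] by blast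
  have disj: "cball z r \<inter> cball z' r = {}" if "z \<in> Z" "z' \<in> Z" "z \<noteq> z'" for z z'
  proof -
    have False if "p \<in> cball z r" "p \<in> cball z' r" for p
      using that rd[OF \<open>z \<in> Z\<close> \<open>z' \<in> Z\<close> \<open>z \<noteq> z'\<close>] dist_triangle2[of z z' p] by (auto simp: dist_commute)
    then show ?thesis by auto
  qed
  define C where "C = closure W - (\<Union>z\<in>Z. ball z r)"
  have C: "compact C" unfolding C_def by (intro compact_diff W open_UN ballI open_ball)
  have sphC: "sphere z r \<subseteq> C" if "z \<in> Z" for z
  proof -
    have "sphere z r \<subseteq> W" using rW[OF that] r by (auto simp: subset_iff)
    moreover have "p \<notin> ball z' r" if "p \<in> sphere z r" "z' \<in> Z" for p z'
      using that disj[OF \<open>z \<in> Z\<close> \<open>z' \<in> Z\<close>] by (cases "z = z'") auto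
    ultimately show ?thesis using WO unfolding C_def by blast
  qed
  have fC: "f z \<noteq> 0" if "z \<in> C" for z
  proof (cases "z \<in> W")
    case True
    with that r show ?thesis by (auto simp: C_def Z_def)
  next
    case False
    with that W(1) have "z \<in> frontier W" by (auto simp: C_def frontier_def interior_open)
    then show ?thesis by (rule nz)
  qed
  have contf: "continuous_on C (\<lambda>z. cmod (f z))"
    using f W by (intro continuous_on_norm holomorphic_on_imp_continuous_on
        holomorphic_on_subset[OF f]) (auto simp: C_def)
  obtain \<epsilon> where \<epsilon>: "\<epsilon> > 0" "\<And>z. z \<in> C \<Longrightarrow> \<epsilon> \<le> cmod (f z)"
  proof (cases "C = {}")
    case True
    then show ?thesis by (intro that[of 1]) auto
  next
    case False
    obtain c where "c \<in> C" "\<forall>z\<in>C. cmod (f c) \<le> cmod (f z)"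
      using continuous_attains_inf[OF C False contf] by blast
    then show ?thesis using fC by (intro that[of "cmod (f c)"]) auto
  qed
  \<comment> \<open>This covers \<open>g = f\<close> too, so that the two counts can be compared disc by disc.\<close>
  have split: "zero_count g W = (\<Sum>z\<in>Z. \<Sum>p | p \<in> ball z r \<and> g p = 0. zorder g p)"
    if g: "g holomorphic_on \<Omega>" and close: "\<And>z. z \<in> closure W \<Longrightarrow> cmod (g z - f z) < \<epsilon>" for g
  proof -
    have gC: "g z \<noteq> 0" if "z \<in> C" for z
      using close[of z] \<epsilon>(2)[OF that] that by (auto simp: C_def)
    have eq: "{p. p \<in> W \<and> g p = 0} = (\<Union>z\<in>Z. {p. p \<in> ball z r \<and> g p = 0})"
      (is "?L = ?R")
    proof
      have "p \<in> (\<Union>z\<in>Z. ball z r)" if "p \<in> W" "g p = 0" for p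
        using gC[of p] that WO unfolding C_def by blast
      then show "?L \<subseteq> ?R" by blast
      have "ball z r \<subseteq> W" if "z \<in> Z" for z using rW[OF that] r by (auto simp: subset_iff)
      then show "?R \<subseteq> ?L" by blast
    qed
    have fin: "finite {p. p \<in> ball z r \<and> g p = 0}" if "z \<in> Z" for z
    proof (rule finite_subset)
      obtain s where s: "s \<in> sphere z r"
        using r by (metis less_imp_le sphere_eq_empty ex_in_conv not_less)
      have "s \<in> C" using sphC[OF that] s by auto
      then have "g s \<noteq> 0" "s \<in> \<Omega>" using gC W by (auto simp: C_def)
      moreover have "cball z r \<subseteq> \<Omega>" using rW[OF that] r WO by (auto simp: subset_iff)
      ultimately show "finite {p \<in> cball z r. g p = 0}"
        by (intro holomorphic_finite_zeros_compact[OF g \<Omega>, of _ s]) auto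
    qed auto
    show ?thesis unfolding zero_count_def eq
    proof (rule sum.UNION_disjoint[OF finZ])
      show "\<forall>z\<in>Z. \<forall>z'\<in>Z. z \<noteq> z' \<longrightarrow> {p. p \<in> ball z r \<and> g p = 0} \<inter> {p. p \<in> ball z' r \<and> g p = 0} = {}"
      proof (intro ballI impI)
        fix z z' assume "z \<in> Z" "z' \<in> Z" "z \<noteq> z'"
        from disj[OF this] show "{p. p \<in> ball z r \<and> g p = 0} \<inter> {p. p \<in> ball z' r \<and> g p = 0} = {}"
          using ball_subset_cball by blast
      qed
    qed (use fin in auto)
  qed
  show thesis
  proof (rule that[OF \<epsilon>(1)])
    fix g assume g: "g holomorphic_on \<Omega>" and close: "\<And>z. z \<in> closure W \<Longrightarrow> cmod (g z - f z) < \<epsilon>"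
    have "(\<Sum>p | p \<in> ball z r \<and> g p = 0. zorder g p) = (\<Sum>p | p \<in> ball z r \<and> f p = 0. zorder f p)"
      if "z \<in> Z" for z
    proof (rule Rouche_disc[of r "2 * r"])
      have "ball z (2 * r) \<subseteq> \<Omega>" using rW[OF that] WO ball_subset_cball by blast
      then show "f holomorphic_on ball z (2 * r)" "g holomorphic_on ball z (2 * r)"
        using f g by (auto intro: holomorphic_on_subset)
      fix w assume "w \<in> sphere z r"
      then have "w \<in> C" using sphC[OF that] by auto
      then show "cmod (g w - f w) < cmod (f w)"
        using close[of w] \<epsilon>(2)[of w] by (auto simp: C_def)
    qed (use r in auto)
    then show "zero_count g W = zero_count f W"
      using split[OF g close] split[OF f] \<epsilon>(1) by simp
  qed
qed

text \<open>
  Joint continuity is uniform on the compact set \<open>{0..1} \<times> closure W\<close>, so by the preceding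
  perturbation lemma the count is locally constant in \<open>t\<close>, hence constant on \<open>{0..1}\<close>.
\<close>

lemma zero_count_homotopy:
  fixes f :: "real \<Rightarrow> complex \<Rightarrow> complex"
  assumes \<Omega>: "open \<Omega>" "connected \<Omega>" and W: "open W" "compact (closure W)" "closure W \<subseteq> \<Omega>"
    and cont: "continuous_on ({0..1} \<times> \<Omega>) (\<lambda>p. f (fst p) (snd p))"
    and hol: "\<And>t. t \<in> {0..1} \<Longrightarrow> f t holomorphic_on \<Omega>"
    and nz: "\<And>t z. t \<in> {0..1} \<Longrightarrow> z \<in> frontier W \<Longrightarrow> f t z \<noteq> 0"
    and nontriv: "z0 \<in> \<Omega>" "\<And>t. t \<in> {0..1} \<Longrightarrow> f t z0 \<noteq> 0"
  shows "zero_count (f 1) W = zero_count (f 0) W"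
proof (rule connected_local_const[of "{0..1::real}" 1 0 "\<lambda>t. zero_count (f t) W"])
  have "uniformly_continuous_on ({0..1} \<times> closure W) (\<lambda>p. f (fst p) (snd p))"
    by (intro compact_uniformly_continuous continuous_on_subset[OF cont] compact_Times W)
      (use W in auto)
  note unif = this[unfolded uniformly_continuous_on_def, rule_format]
  show "\<forall>t\<in>{0..1}. \<forall>\<^sub>F s in at t within {0..1}. zero_count (f t) W = zero_count (f s) W"
  proof
    fix t :: real assume t: "t \<in> {0..1}"
    obtain \<epsilon> where \<epsilon>: "\<epsilon> > 0"
      "\<And>g. g holomorphic_on \<Omega> \<Longrightarrow> (\<And>z. z \<in> closure W \<Longrightarrow> cmod (g z - f t z) < \<epsilon>)
         \<Longrightarrow> zero_count g W = zero_count (f t) W"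
      using zero_count_near[OF \<Omega> W hol[OF t] nz[OF t] nontriv(1) nontriv(2)[OF t]] by blast
    obtain d where d: "d > 0"
      "\<And>p q. p \<in> {0..1} \<times> closure W \<Longrightarrow> q \<in> {0..1} \<times> closure W \<Longrightarrow> dist q p < d \<Longrightarrow>
        dist (f (fst q) (snd q)) (f (fst p) (snd p)) < \<epsilon>"
      using unif[OF \<epsilon>(1)] by blast
    show "\<forall>\<^sub>F s in at t within {0..1}. zero_count (f t) W = zero_count (f s) W"
      unfolding eventually_at
    proof (intro exI[of _ d] conjI ballI impI d(1))
      fix s assume s: "s \<in> {0..1}" "s \<noteq> t \<and> dist s t < d"
      have "cmod (f s z - f t z) < \<epsilon>" if "z \<in> closure W" for z
        using d(2)[of "(t, z)" "(s, z)"] s t that by (auto simp: dist_norm dist_Pair_Pair)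
      then show "zero_count (f t) W = zero_count (f s) W"
        using \<epsilon>(2)[OF hol[OF s(1)]] by simp
    qed
  qed
qed auto

section \<open>A maximum principle for products of powers of sums of moduli\<close>

text \<open>
  A substitute for log-subharmonicity that carries just enough information for the maximum
  principle: \<open>h\<close> is touched from below at \<open>z\<close> by the modulus of a holomorphic function.
  Products of nonnegative functions inherit it directly, by multiplying the minorants.
\<close>

definition has_holomorphic_minorant_at :: "(complex \<Rightarrow> real) \<Rightarrow> complex \<Rightarrow> bool" where
  "has_holomorphic_minorant_at h z \<longleftrightarrow>
    (\<exists>r>0. \<exists>\<phi>. \<phi> holomorphic_on ball z r \<and> cmod (\<phi> z) = h z \<and> (\<forall>w\<in>ball z r. cmod (\<phi> w) \<le> h w))"

lemma minorant_mult:
  assumes "has_holomorphic_minorant_at h z" "has_holomorphic_minorant_at k z"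
  shows "has_holomorphic_minorant_at (\<lambda>w. h w * k w) z"
proof -
  obtain r \<phi> where 1: "0 < r" "\<phi> holomorphic_on ball z r" "cmod (\<phi> z) = h z"
    "\<And>w. w \<in> ball z r \<Longrightarrow> cmod (\<phi> w) \<le> h w"
    using assms(1) unfolding has_holomorphic_minorant_at_def by blast
  obtain s \<psi> where 2: "0 < s" "\<psi> holomorphic_on ball z s" "cmod (\<psi> z) = k z"
    "\<And>w. w \<in> ball z s \<Longrightarrow> cmod (\<psi> w) \<le> k w"
    using assms(2) unfolding has_holomorphic_minorant_at_def by blast
  have "(\<lambda>w. \<phi> w * \<psi> w) holomorphic_on ball z (min r s)"
    using 1(2) 2(2) by (intro holomorphic_on_mult) (auto elim!: holomorphic_on_subset)
  moreover have "cmod (\<phi> w * \<psi> w) \<le> h w * k w" if "w \<in> ball z (min r s)" for w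
    unfolding norm_mult using 1(4)[of w] 2(4)[of w] that
    by (intro mult_mono) (auto intro: order_trans[OF norm_ge_zero])
  ultimately show ?thesis
    unfolding has_holomorphic_minorant_at_def
    using 1 2 by (intro exI[of _ "min r s"] exI[of _ "\<lambda>w. \<phi> w * \<psi> w"] conjI ballI)
      (auto simp: norm_mult)
qed

lemma minorant_norm:
  assumes "f holomorphic_on S" "open S" "z \<in> S"
  shows "has_holomorphic_minorant_at (\<lambda>w. cmod (f w)) z"
proof -
  obtain r where "0 < r" "ball z r \<subseteq> S" using assms by (meson open_contains_ball)
  then show ?thesis
    unfolding has_holomorphic_minorant_at_def using assms(1)
    by (intro exI[of _ r] exI[of _ f]) (auto elim!: holomorphic_on_subset)
qed

text \<open>
  Rotating each \<open>f k\<close> by a constant phase that makes its value at \<open>z\<close> positive, and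
  dropping those that vanish at \<open>z\<close> (where \<open>sgn\<close> is 0), turns the sum of moduli at \<open>z\<close>
  into the modulus of a holomorphic sum, and the triangle inequality makes the latter a
  minorant elsewhere. Near \<open>z\<close> this sum has positive real part, so its real powers are
  holomorphic.
\<close>

lemma minorant_rpow_sum_norm:
  assumes f: "\<And>k. k \<in> I \<Longrightarrow> f k holomorphic_on S" and S: "open S" "z \<in> S" and a: "0 \<le> a"
    and pos: "0 < rpow (\<Sum>k\<in>I. cmod (f k z)) a"
  shows "has_holomorphic_minorant_at (\<lambda>w. rpow (\<Sum>k\<in>I. cmod (f k w)) a) z"
proof (cases "a = 0")
  case True
  then show ?thesis using minorant_norm[of "\<lambda>_. 1" UNIV z] by (simp add: rpow_def)
next
  case False
  define R where "R w = (\<Sum>k\<in>I. cmod (f k w))" for w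
  have R0: "0 \<le> R w" for w unfolding R_def by (intro sum_nonneg) simp
  have Rp: "0 < R z" using pos False R0[of z] by (cases "R z = 0") (auto simp: rpow_def R_def)
  define F where "F w = (\<Sum>k\<in>I. cnj (sgn (f k z)) * f k w)" for w
  have holF: "F holomorphic_on S" unfolding F_def by (intro holomorphic_intros f)
  have Fz: "F z = of_real (R z)"
  proof -
    have "cnj (sgn x) * x = of_real (cmod x)" for x :: complex
      by (simp add: sgn_eq mult.commute[of "cnj x"] complex_norm_square[symmetric] power2_eq_square)
    then show ?thesis by (simp add: F_def R_def)
  qed
  have Fle: "cmod (F w) \<le> R w" for w
  proof -
    have "cmod (F w) \<le> (\<Sum>k\<in>I. cmod (cnj (sgn (f k z)) * f k w))"
      unfolding F_def by (rule norm_sum)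
    also have "\<dots> \<le> R w" unfolding R_def
      by (intro sum_mono) (auto simp: norm_mult norm_sgn)
    finally show ?thesis .
  qed
  have "continuous_on S (\<lambda>w. Re (F w))"
    by (intro continuous_intros holomorphic_on_imp_continuous_on holF)
  then have "open (S \<inter> (\<lambda>w. Re (F w)) -` {0<..})"
    using S by (intro continuous_open_preimage) auto
  moreover have "z \<in> S \<inter> (\<lambda>w. Re (F w)) -` {0<..}" using S Fz Rp by simp
  ultimately obtain r where r: "0 < r" "ball z r \<subseteq> S \<inter> (\<lambda>w. Re (F w)) -` {0<..}"
    by (meson open_contains_ball)
  have "(\<lambda>w. F w powr of_real a) holomorphic_on ball z r"
    using r by (intro holomorphic_intros holomorphic_on_subset[OF holF])
      (auto simp: complex_nonpos_Reals_iff subset_iff)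
  moreover have "cmod (F w powr of_real a) = cmod (F w) powr a" for w
    by (simp add: norm_powr_real_powr')
  ultimately show ?thesis
    unfolding has_holomorphic_minorant_at_def
    using r Fz Rp False a Fle
    by (intro exI[of _ r] exI[of _ "\<lambda>w. F w powr of_real a"] conjI ballI)
      (auto simp: rpow_def norm_powr_real_powr' R_def[symmetric] intro: powr_mono2)
qed

text \<open>
  At a maximum point in \<open>W\<close> the minorant itself has a local maximum of its modulus, so it is
  constant nearby and forces \<open>h\<close> to stay at the maximal value. If the maximum were at least \<open>B\<close>,
  it would not be attained on the frontier, and the set of maximum points would be a nonempty
  bounded set that is both open and closed in the plane.
\<close>

lemma maximum_principle_of_minorants:
  fixes h :: "complex \<Rightarrow> real"
  assumes W: "open W" "compact (closure W)" and h: "continuous_on (closure W) h"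
    and B: "0 < B" "\<And>z. z \<in> frontier W \<Longrightarrow> h z < B"
    and min: "\<And>z. z \<in> W \<Longrightarrow> 0 < h z \<Longrightarrow> has_holomorphic_minorant_at h z"
    and z: "z \<in> W"
  shows "h z < B"
proof (rule ccontr)
  assume "\<not> h z < B"
  have WC: "W \<subseteq> closure W" by (rule closure_subset)
  obtain m where m: "m \<in> closure W" "\<And>w. w \<in> closure W \<Longrightarrow> h w \<le> h m"
    using continuous_attains_sup[OF W(2) _ h] z WC by blast
  have mB: "B \<le> h m" using m(2)[of z] z WC \<open>\<not> h z < B\<close> by auto
  define M where "M = {w\<in>closure W. h w = h m}"
  have MW: "M \<subseteq> W"
    using B(2) mB W(1) by (force simp: M_def frontier_def interior_open)
  have mW: "m \<in> W" using MW m by (auto simp: M_def)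
  have "closed M"
  proof -
    have "M = {w\<in>closure W. h w \<in> {h m}}" by (auto simp: M_def)
    then show ?thesis
      using continuous_closed_preimage[OF h closed_closure closed_singleton[of "h m"]]
      by (simp add: vimage_def Int_def)
  qed
  moreover have "open M"
  proof (subst open_contains_ball, intro ballI)
    fix x assume x: "x \<in> M"
    then have xW: "x \<in> W" and hx: "h x = h m" using MW by (auto simp: M_def)
    obtain r \<phi> where \<phi>: "0 < r" "\<phi> holomorphic_on ball x r" "cmod (\<phi> x) = h x"
      "\<And>w. w \<in> ball x r \<Longrightarrow> cmod (\<phi> w) \<le> h w"
      using min[OF xW] hx mB B(1) unfolding has_holomorphic_minorant_at_def by auto
    obtain s where s: "0 < s" "ball x s \<subseteq> ball x r \<inter> W"
      using \<phi>(1) xW W(1) by (meson IntI centre_in_ball open_Int open_ball open_contains_ball)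
    have le: "cmod (\<phi> w) \<le> cmod (\<phi> x)" if "w \<in> ball x s" for w
    proof -
      have "cmod (\<phi> w) \<le> h w" using that s \<phi>(4) by blast
      also have "\<dots> \<le> h m" using that s WC by (intro m(2)) blast
      finally show ?thesis using \<phi>(3) hx by simp
    qed
    have "\<phi> constant_on ball x s"
    proof (rule maximum_modulus_principle[of \<phi> "ball x s" "ball x s" x])
      show "\<phi> holomorphic_on ball x s" using \<phi>(2) s by (auto intro: holomorphic_on_subset)
    qed (use s le in auto)
    then have const: "\<phi> w = \<phi> x" if "w \<in> ball x s" for w
      using that s(1) by (metis centre_in_ball constant_on_def)
    have "w \<in> M" if "w \<in> ball x s" for w
    proof -
      have "h m \<le> h w" using const[OF that] \<phi>(3) \<phi>(4)[of w] hx that s by auto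
      moreover have "w \<in> closure W" using that s WC by blast
      ultimately show ?thesis using m(2)[of w] by (simp add: M_def)
    qed
    then show "\<exists>e>0. ball x e \<subseteq> M" using s(1) by blast
  qed
  ultimately have "M = {} \<or> M = UNIV" using clopen by blast
  moreover have "m \<in> M" using m(1) by (simp add: M_def)
  ultimately have "M = UNIV" by blast
  then have "closure W = UNIV" by (auto simp: M_def)
  then show False using W(2) not_bounded_UNIV compact_imp_bounded by metis
qed

section \<open>Isolating compact components\<close>

text \<open>
  A component of \<open>G\<close> need not be open in \<open>G\<close>, because other components may accumulate at it.
  By the Sura-Bura theorem a compact one nevertheless has arbitrarily small neighbourhoods in
  \<open>G\<close> that are both compact and open in \<open>G\<close>. Such a set \<open>K\<close> has a plane neighbourhood \<open>W\<close> whose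
  closure meets \<open>G\<close> in \<open>K\<close> alone, so that the frontier of \<open>W\<close> misses \<open>G\<close>.
\<close>

lemma isolating_neighbourhood:
  fixes G :: "complex set"
  assumes \<Omega>: "open \<Omega>" and G: "closedin (top_of_set \<Omega>) G"
    and C: "C \<in> components G" "compact C" and V: "open V" "C \<subseteq> V"
  obtains W where "open W" "C \<subseteq> W" "compact (closure W)" "closure W \<subseteq> \<Omega>" "closure W \<subseteq> V"
    "frontier W \<inter> G = {}"
proof -
  have "locally compact G"
    using G \<Omega> locally_compact_closedin open_imp_locally_compact by blast
  then obtain K where K: "openin (top_of_set G) K" "compact K" "C \<subseteq> K" "K \<subseteq> V"
    using Sura_Bura_clopen_subset[OF _ C V] by blast
  obtain Q where Q: "open Q" "K = G \<inter> Q" using K(1) by (auto simp: openin_open)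
  have "K \<subseteq> Q \<inter> \<Omega> \<inter> V" using Q K G by (auto dest: closedin_imp_subset)
  then obtain e where e: "0 < e" "(\<Union>x\<in>K. cball x e) \<subseteq> Q \<inter> \<Omega> \<inter> V"
    using compact_subset_open_imp_cball_epsilon_subset[OF K(2), of "Q \<inter> \<Omega> \<inter> V"] Q \<Omega> V by blast
  define W where "W = (\<Union>x\<in>K. ball x e)"
  have comp: "compact (\<Union>x\<in>K. cball x e)" by (rule compact_minkowski_sum_cball[OF K(2)])
  have cl: "closure W \<subseteq> (\<Union>x\<in>K. cball x e)"
    unfolding W_def by (intro closure_minimal compact_imp_closed comp UN_mono) auto
  have KW: "K \<subseteq> W" using e by (auto simp: W_def)
  show thesis
  proof
    show "open W" unfolding W_def by auto
    then have "frontier W \<inter> W = {}" by (auto simp: frontier_def interior_open)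
    moreover have "frontier W \<inter> G \<subseteq> K" using cl e Q by (auto simp: frontier_def)
    ultimately show "frontier W \<inter> G = {}" using KW by blast
    show "compact (closure W)"
      using cl comp by (metis closed_closure compact_Int_closed inf.absorb_iff2)
  qed (use KW K cl e in auto)
qed

lemma compact_component:
  fixes G :: "complex set"
  assumes G: "closedin (top_of_set \<Omega>) G" and C: "C \<in> components G" "bounded C" "closure C \<subseteq> \<Omega>"
  shows "compact C"
proof -
  have "closedin (top_of_set \<Omega>) C" using closedin_component[OF C(1)] G by (rule closedin_trans)
  then obtain Q where "closed Q" "C = \<Omega> \<inter> Q" by (auto simp: closedin_closed)
  then have "closure C \<subseteq> C" using C(3) by (metis closure_minimal inf_le2 le_inf_iff)
  then show ?thesis using C(2) by (metis bounded_closure closure_subset compact_closure subset_antisym)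
qed

section \<open>Gershgorin regions\<close>

abbreviation gersh_bound :: "complex ^ 'n ^ 'n \<Rightarrow> real \<Rightarrow> 'n \<Rightarrow> real" where
  "gersh_bound A a j \<equiv> rpow (abs_row_sum A j) a * rpow (abs_col_sum A j) (1 - a)"

lemma analytic_matrix_entry_holomorphic:
  "analytic_matrix_on F \<Omega> \<Longrightarrow> (\<lambda>z. F z $ i $ j) holomorphic_on \<Omega>"
  by (simp add: analytic_matrix_on_def analytic_imp_holomorphic)

lemma analytic_matrix_entry_continuous:
  "analytic_matrix_on F \<Omega> \<Longrightarrow> continuous_on \<Omega> (\<lambda>z. F z $ i $ j)"
  by (intro holomorphic_on_imp_continuous_on analytic_matrix_entry_holomorphic)

lemma det_holomorphic:
  "analytic_matrix_on F \<Omega> \<Longrightarrow> (\<lambda>z. det (F z)) holomorphic_on \<Omega>"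
  unfolding det_def by (intro holomorphic_intros analytic_matrix_entry_holomorphic)

lemma continuous_on_gersh_bound:
  assumes "analytic_matrix_on E \<Omega>" "0 \<le> a" "a \<le> 1"
  shows "continuous_on \<Omega> (\<lambda>z. gersh_bound (E z) a j)"
proof -
  have "continuous_on \<Omega> (\<lambda>z. abs_row_sum (E z) j)" "continuous_on \<Omega> (\<lambda>z. abs_col_sum (E z) j)"
    unfolding abs_row_sum_def abs_col_sum_def
    by (intro continuous_intros analytic_matrix_entry_continuous[OF assms(1)])+
  then show ?thesis
    using assms by (intro continuous_on_mult continuous_on_rpow abs_row_sum_nonneg abs_col_sum_nonneg) auto
qed

lemma closedin_gersh_region:
  assumes "analytic_matrix_on D \<Omega>" "analytic_matrix_on E \<Omega>" "0 \<le> a" "a \<le> 1"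
  shows "closedin (top_of_set \<Omega>) (gersh_region \<Omega> D E a j)"
proof -
  have "continuous_on \<Omega> (\<lambda>z. gersh_bound (E z) a j - cmod (D z $ j $ j))"
    by (intro continuous_intros continuous_on_gersh_bound analytic_matrix_entry_continuous assms)
  then have "closedin (top_of_set \<Omega>)
      (\<Omega> \<inter> (\<lambda>z. gersh_bound (E z) a j - cmod (D z $ j $ j)) -` {0..})"
    by (rule continuous_closedin_preimage) simp
  moreover have "\<Omega> \<inter> (\<lambda>z. gersh_bound (E z) a j - cmod (D z $ j $ j)) -` {0..}
      = gersh_region \<Omega> D E a j"
    by (auto simp: gersh_region_def)
  ultimately show ?thesis by simp
qed

text \<open>
  Without a zero of \<open>d\<^sub>j\<^sub>j\<close> on \<open>C\<close>, the quotient \<open>h = r\<^sub>j\<^sup>a c\<^sub>j\<^sup>1\<^sup>-\<^sup>a / \<bar>d\<^sub>j\<^sub>j\<bar>\<close> is continuous near \<open>C\<close> and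
  has holomorphic minorants wherever it is positive. The region is \<open>{h \<ge> 1}\<close>, so \<open>h < 1\<close> on the
  frontier of an isolating neighbourhood of \<open>C\<close> although \<open>h \<ge> 1\<close> on \<open>C\<close>, against the
  maximum principle.
\<close>

lemma gersh_component_contains_diagonal_zero:
  fixes D E :: "complex \<Rightarrow> complex ^ 'n ^ 'n"
  assumes \<Omega>: "open \<Omega>" and D: "analytic_matrix_on D \<Omega>" and E: "analytic_matrix_on E \<Omega>"
    and a: "0 \<le> a" "a \<le> 1"
    and C: "C \<in> components (gersh_region \<Omega> D E a j)" "bounded C" "closure C \<subseteq> \<Omega>"
  obtains z where "z \<in> C" "D z $ j $ j = 0"
proof -
  have False if nz: "\<And>z. z \<in> C \<Longrightarrow> D z $ j $ j \<noteq> 0"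
  proof -
    define G where "G = gersh_region \<Omega> D E a j"
    have Gcl: "closedin (top_of_set \<Omega>) G"
      unfolding G_def by (rule closedin_gersh_region[OF D E a])
    have comp: "compact C" using compact_component[OF Gcl] C by (simp add: G_def)
    have CG: "C \<subseteq> G" "C \<noteq> {}"
      using C(1) in_components_subset in_components_nonempty by (auto simp: G_def)
    define V where "V = \<Omega> \<inter> (\<lambda>z. D z $ j $ j) -` (- {0})"
    have "open V" unfolding V_def
      by (intro continuous_open_preimage analytic_matrix_entry_continuous[OF D] \<Omega>) auto
    moreover have "C \<subseteq> V" using CG nz by (auto simp: V_def G_def gersh_region_def)
    ultimately obtain W where W: "open W" "C \<subseteq> W" "compact (closure W)" "closure W \<subseteq> V"
        "frontier W \<inter> G = {}"
      using isolating_neighbourhood[OF \<Omega> Gcl C(1)[folded G_def] comp] by metis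
    have V\<Omega>: "V \<subseteq> \<Omega>" by (auto simp: V_def)
    have dnz: "D z $ j $ j \<noteq> 0" if "z \<in> V" for z using that by (auto simp: V_def)
    define h where "h z = gersh_bound (E z) a j * cmod (1 / D z $ j $ j)" for z
    obtain z where z: "z \<in> C" using CG by blast
    have "h z < 1"
    proof (rule maximum_principle_of_minorants[OF W(1,3)])
      show "continuous_on (closure W) h"
        unfolding h_def using W V\<Omega> dnz
        by (intro continuous_intros continuous_on_subset[OF continuous_on_gersh_bound[OF E a]]
            continuous_on_subset[OF analytic_matrix_entry_continuous[OF D]]) auto
      show "h w < 1" if "w \<in> frontier W" for w
      proof -
        have w: "w \<in> V" "w \<notin> G" using that W by (auto simp: frontier_def)
        then have "gersh_bound (E w) a j < cmod (D w $ j $ j)"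
          using V\<Omega> by (auto simp: G_def gersh_region_def not_le)
        then show ?thesis using dnz[OF w(1)] by (simp add: h_def norm_divide divide_less_eq)
      qed
      show "has_holomorphic_minorant_at h w" if "w \<in> W" "0 < h w" for w
      proof -
        have wV: "w \<in> V" using that W closure_subset by blast
        have "gersh_bound (E w) a j \<noteq> 0" using that(2) by (auto simp: h_def)
        then have pos: "0 < rpow (abs_row_sum (E w) j) a" "0 < rpow (abs_col_sum (E w) j) (1 - a)"
          using rpow_nonneg[OF abs_row_sum_nonneg] rpow_nonneg[OF abs_col_sum_nonneg]
          by (auto simp: less_le)
        have holE: "(\<lambda>z. E z $ i $ k) holomorphic_on V" for i k
          by (rule holomorphic_on_subset[OF analytic_matrix_entry_holomorphic[OF E] V\<Omega>])
        have "(\<lambda>z. 1 / D z $ j $ j) holomorphic_on V"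
          by (intro holomorphic_intros holomorphic_on_subset[OF analytic_matrix_entry_holomorphic[OF D] V\<Omega>] dnz)
        note minorant_norm[OF this \<open>open V\<close> wV]
        moreover have "has_holomorphic_minorant_at (\<lambda>z. rpow (abs_row_sum (E z) j) a) w"
          unfolding abs_row_sum_def
          by (rule minorant_rpow_sum_norm[OF holE \<open>open V\<close> wV a(1)])
            (use pos in \<open>simp add: abs_row_sum_def\<close>)
        moreover have "has_holomorphic_minorant_at (\<lambda>z. rpow (abs_col_sum (E z) j) (1 - a)) w"
          unfolding abs_col_sum_def
          by (rule minorant_rpow_sum_norm[OF holE \<open>open V\<close> wV])
            (use pos a in \<open>simp_all add: abs_col_sum_def\<close>)
        ultimately show ?thesis unfolding h_def by (intro minorant_mult)
      qed
    qed (use z W in auto)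
    moreover have "1 \<le> h z"
    proof -
      have "z \<in> V" using z W closure_subset by blast
      moreover have "cmod (D z $ j $ j) \<le> gersh_bound (E z) a j"
        using z CG by (auto simp: G_def gersh_region_def)
      ultimately show ?thesis using dnz[of z] by (simp add: h_def norm_divide le_divide_eq)
    qed
    ultimately show False by simp
  qed
  then show thesis using that by blast
qed

lemma det_nonzero_outside_gersh:
  fixes D E :: "complex \<Rightarrow> complex ^ 'n ^ 'n"
  assumes diag: "\<And>i j. i \<noteq> j \<Longrightarrow> D z $ i $ j = 0" and a: "0 \<le> a" "a \<le> 1"
    and z: "z \<in> \<Omega>" "z \<notin> (\<Union>j. gersh_region \<Omega> D E a j)" and t: "0 \<le> t" "t \<le> 1"
  shows "det (D z + t *\<^sub>R E z) \<noteq> 0"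
proof (rule diagonal_plus_det_nonzero[OF diag a])
  fix j
  have "gersh_bound (E z) a j < cmod (D z $ j $ j)"
    using z by (auto simp: gersh_region_def not_le)
  then show "gersh_bound (t *\<^sub>R E z) a j < cmod (D z $ j $ j)"
    using gersh_bound_scale[OF t a, of "E z" j] by linarith
qed

section \<open>Counting eigenvalues\<close>

text \<open>
  The truncation by \<open>nat\<close> in \<open>eig_mult\<close> is harmless because a holomorphic function that is
  not identically zero has nonnegative orders. The zeros are located by an equality of sets so
  that an open \<open>W\<close> can stand in for the component \<open>U\<close>.
\<close>

lemma int_eig_count:
  assumes \<Omega>: "open \<Omega>" "connected \<Omega>" and F: "analytic_matrix_on F \<Omega>"
    and nz: "q \<in> \<Omega>" "det (F q) \<noteq> 0"
    and eq: "{p \<in> W. det (F p) = 0} = spectrum \<Omega> F \<inter> U"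
  shows "int (eig_count \<Omega> F U) = zero_count (\<lambda>w. det (F w)) W"
proof -
  have "int (eig_mult F z) = zorder (\<lambda>w. det (F w)) z" if "z \<in> \<Omega>" for z
  proof -
    have hol: "(\<lambda>w. det (F w)) holomorphic_on \<Omega>" by (rule det_holomorphic[OF F])
    then have "(\<lambda>w. det (F w)) analytic_on {z}"
      using \<Omega>(1) that by (meson analytic_at)
    moreover have "\<forall>\<^sub>F w in at z. det (F w) \<noteq> 0"
      using non_zero_neighbour_alt[OF hol \<Omega> that nz] by (rule eventually_mono) simp
    ultimately have "0 \<le> zorder (\<lambda>w. det (F w)) z"
      by (intro zorder_ge_0 eventually_frequently) auto
    then show ?thesis by (simp add: eig_mult_def)
  qed
  then have "int (eig_count \<Omega> F U) = (\<Sum>z\<in>spectrum \<Omega> F \<inter> U. zorder (\<lambda>w. det (F w)) z)"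
    unfolding eig_count_def of_nat_sum by (intro sum.cong) (auto simp: spectrum_def)
  then show ?thesis unfolding zero_count_def using eq by simp
qed

text \<open>
  The order of \<open>det D = \<Prod>j. d\<^sub>j\<^sub>j\<close> is the sum of the orders of its factors.
\<close>

lemma diagonal_eig_mult_ge:
  fixes D :: "complex \<Rightarrow> complex ^ 'n ^ 'n"
  assumes \<Omega>: "open \<Omega>" "connected \<Omega>" and D: "analytic_matrix_on D \<Omega>"
    and diag: "\<And>z i j. z \<in> \<Omega> \<Longrightarrow> i \<noteq> j \<Longrightarrow> D z $ i $ j = 0"
    and nz: "q \<in> \<Omega>" "det (D q) \<noteq> 0" and z: "z \<in> \<Omega>"
  shows "card {j. D z $ j $ j = 0} \<le> eig_mult D z"
proof -
  have det: "det (D w) = (\<Prod>j\<in>UNIV. D w $ j $ j)" if "w \<in> \<Omega>" for w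
    using diag[OF that] by (rule det_diagonal)
  have nzd: "\<forall>\<^sub>F w in at z. det (D w) \<noteq> 0 \<and> w \<in> \<Omega>"
    by (rule non_zero_neighbour_alt[OF det_holomorphic[OF D] \<Omega> z nz])
  then have nzp: "\<forall>\<^sub>F w in at z. (\<Prod>j\<in>UNIV. D w $ j $ j) \<noteq> 0"
    by (rule eventually_mono) (auto simp: det)
  have ana: "(\<lambda>w. D w $ j $ j) analytic_on {z}" for j
    using D z by (auto simp: analytic_matrix_on_def intro: analytic_on_subset)
  have "zorder (\<lambda>w. det (D w)) z = zorder (\<lambda>w. \<Prod>j\<in>UNIV. D w $ j $ j) z"
    by (rule zorder_cong) (use nzd det in \<open>auto elim: eventually_mono\<close>)
  also have "\<dots> = (\<Sum>j\<in>UNIV. zorder (\<lambda>w. D w $ j $ j) z)"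
    by (rule zorder_prod_analytic[OF ana nzp])
  also have "\<dots> \<ge> (\<Sum>j\<in>UNIV. if D z $ j $ j = 0 then 1 else 0)"
  proof (rule sum_mono)
    fix j
    have "\<forall>\<^sub>F w in at z. D w $ j $ j \<noteq> 0" using nzp by (rule eventually_mono) auto
    then have "\<exists>\<^sub>F w in at z. D w $ j $ j \<noteq> 0" by (intro eventually_frequently) auto
    then show "(if D z $ j $ j = 0 then 1 else 0) \<le> zorder (\<lambda>w. D w $ j $ j) z"
      using zorder_ge_0[OF ana] zorder_pos_iff'[OF ana, of j] by auto
  qed
  finally have "int (card {j. D z $ j $ j = 0}) \<le> zorder (\<lambda>w. det (D w)) z"
    by (simp add: sum.If_cases)
  then show ?thesis by (simp add: eig_mult_def)
qed

text \<open>
  Each tagged component \<open>(j, C)\<close> supplies a zero of \<open>d\<^sub>j\<^sub>j\<close> in \<open>C\<close>. Components of one region are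
  disjoint, so these zeros together with their index are distinct pairs, and the multiplicity
  of \<open>D\<close> at a point is at least the number of indices for which the diagonal entry vanishes.
\<close>

lemma card_gersh_components_le_diagonal_eig_count:
  fixes D E :: "complex \<Rightarrow> complex ^ 'n ^ 'n"
  assumes \<Omega>: "open \<Omega>" "connected \<Omega>" and D: "analytic_matrix_on D \<Omega>" and E: "analytic_matrix_on E \<Omega>"
    and diag: "\<And>z i j. z \<in> \<Omega> \<Longrightarrow> i \<noteq> j \<Longrightarrow> D z $ i $ j = 0"
    and a: "0 \<le> a" "a \<le> 1"
    and nz: "q \<in> \<Omega>" "det (D q) \<noteq> 0"
    and U: "bounded U" "closure U \<subseteq> \<Omega>" and fin: "finite (spectrum \<Omega> D \<inter> U)"
    and P: "P \<subseteq> gersh_components \<Omega> D E a" "\<And>j C. (j, C) \<in> P \<Longrightarrow> C \<subseteq> U"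
  shows "card P \<le> eig_count \<Omega> D U"
proof -
  have "\<exists>z. z \<in> C \<and> D z $ j $ j = 0" if jC: "(j, C) \<in> P" for j C
  proof -
    have "C \<in> components (gersh_region \<Omega> D E a j)"
      using P(1) jC by (auto simp: gersh_components_def)
    moreover have "bounded C" "closure C \<subseteq> \<Omega>"
      using P(2)[OF jC] U bounded_subset closure_mono by blast+
    ultimately show ?thesis
      using gersh_component_contains_diagonal_zero[OF \<Omega>(1) D E a] by metis
  qed
  then obtain \<zeta> where \<zeta>: "\<And>j C. (j, C) \<in> P \<Longrightarrow> \<zeta> j C \<in> C \<and> D (\<zeta> j C) $ j $ j = 0"
    by metis
  define Q where "Q = (SIGMA z:spectrum \<Omega> D \<inter> U. {j. D z $ j $ j = 0})"
  have finQ: "finite Q" unfolding Q_def using fin by (intro finite_SigmaI) auto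
  have "card P \<le> card Q"
  proof (rule card_inj_on_le[of "\<lambda>(j, C). (\<zeta> j C, j)"])
    show "inj_on (\<lambda>(j, C). (\<zeta> j C, j)) P"
    proof (rule inj_onI, clarsimp)
      fix j C C' assume jC: "(j, C) \<in> P" "(j, C') \<in> P" and eq: "\<zeta> j C = \<zeta> j C'"
      have "\<zeta> j C \<in> C \<inter> C'" using \<zeta>[OF jC(1)] \<zeta>[OF jC(2)] eq by simp
      moreover have "C \<in> components (gersh_region \<Omega> D E a j)" "C' \<in> components (gersh_region \<Omega> D E a j)"
        using P(1) jC by (auto simp: gersh_components_def)
      ultimately show "C = C'" using components_eq by blast
    qed
    show "(\<lambda>(j, C). (\<zeta> j C, j)) ` P \<subseteq> Q"
    proof clarify
      fix j C assume jC: "(j, C) \<in> P"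
      have z: "\<zeta> j C \<in> U" "D (\<zeta> j C) $ j $ j = 0" using \<zeta>[OF jC] P(2)[OF jC] by auto
      have "\<zeta> j C \<in> \<Omega>" using z U closure_subset by blast
      then have "det (D (\<zeta> j C)) = 0"
        using det_diagonal[of "D (\<zeta> j C)"] diag z(2) by (auto simp: prod_zero_iff)
      then show "(\<zeta> j C, j) \<in> Q"
        using z \<open>\<zeta> j C \<in> \<Omega>\<close> by (auto simp: Q_def spectrum_def invertible_det_nz)
    qed
  qed (rule finQ)
  also have "card Q = (\<Sum>z\<in>spectrum \<Omega> D \<inter> U. card {j. D z $ j $ j = 0})"
    unfolding Q_def using fin by (intro card_SigmaI) auto
  also have "\<dots> \<le> eig_count \<Omega> D U"
    unfolding eig_count_def
    by (intro sum_mono diagonal_eig_mult_ge[OF \<Omega> D diag nz]) (auto simp: spectrum_def)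
  finally show ?thesis .
qed

text \<open>
  If \<open>G\<close> were all of the connected set \<open>\<Omega>\<close>, the component would be \<open>\<Omega>\<close> itself: a
  nonempty bounded set, open and closed in the plane. For the union of the regions, the point
  outside shows that the determinants along the homotopy do not vanish identically.
\<close>

lemma component_outside_point:
  fixes \<Omega> :: "complex set"
  assumes \<Omega>: "open \<Omega>" "connected \<Omega>" and G: "G \<subseteq> \<Omega>"
    and U: "U \<in> components G" "bounded U" "closure U \<subseteq> \<Omega>"
  obtains q where "q \<in> \<Omega>" "q \<notin> G"
proof -
  have False if "G = \<Omega>"
  proof -
    have "U = \<Omega>" using U(1) that \<Omega>(2) in_components_maximal[of U G] 
      by (metis connected_eq_components_subset_sing singletonD subsetD)
    then have "closed U" "open U" using U(3) \<Omega> closure_subset_eq by auto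
    then have "U = {} \<or> U = UNIV" using clopen by blast
    then show False using U in_components_nonempty not_bounded_UNIV by metis
  qed
  then show thesis using that G by blast
qed

text \<open>
  The homotopy is \<open>D + t (T - D)\<close> rather than \<open>D + t E\<close> so that its end point is \<open>T\<close> as a
  function on the whole plane. Its determinant has no zero off the regions, in particular
  none on the frontier of an isolating neighbourhood \<open>W\<close> of \<open>U\<close>. To make a count in \<open>W\<close> a
  count in \<open>U\<close>, the finitely many zeros of both end points that lie near \<open>U\<close> but not in it
  are excluded from \<open>W\<close>.
\<close>

lemma eig_counts_agree:
  fixes T D E :: "complex \<Rightarrow> complex ^ 'n ^ 'n"
  assumes \<Omega>: "open \<Omega>" "connected \<Omega>" and T: "analytic_matrix_on T \<Omega>"
    and D: "analytic_matrix_on D \<Omega>" and E: "analytic_matrix_on E \<Omega>"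
    and TDE: "\<And>z. z \<in> \<Omega> \<Longrightarrow> T z = D z + E z"
    and diag: "\<And>z i j. z \<in> \<Omega> \<Longrightarrow> i \<noteq> j \<Longrightarrow> D z $ i $ j = 0"
    and a: "0 \<le> a" "a \<le> 1"
    and U: "U \<in> components (\<Union>j. gersh_region \<Omega> D E a j)" "bounded U" "closure U \<subseteq> \<Omega>"
    and q: "q \<in> \<Omega>" "q \<notin> (\<Union>j. gersh_region \<Omega> D E a j)"
  shows "finite (spectrum \<Omega> T \<inter> U)" "finite (spectrum \<Omega> D \<inter> U)"
    and "eig_count \<Omega> T U = eig_count \<Omega> D U"
proof -
  define G where "G = (\<Union>j. gersh_region \<Omega> D E a j)"
  have Gcl: "closedin (top_of_set \<Omega>) G"
    unfolding G_def by (intro closedin_Union) (auto intro: closedin_gersh_region[OF D E a])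
  have UG: "U \<in> components G" using U(1) by (simp add: G_def)
  have comp: "compact U" by (rule compact_component[OF Gcl UG U(2,3)])
  have U\<Omega>: "U \<subseteq> \<Omega>" using U(3) closure_subset by blast
  define f where "f t z = det (D z + t *\<^sub>R (T z - D z))" for t :: real and z
  have f0: "f 0 = (\<lambda>z. det (D z))" and f1: "f 1 = (\<lambda>z. det (T z))" by (auto simp: f_def)
  have fnz: "f t z \<noteq> 0" if "t \<in> {0..1}" "z \<in> \<Omega>" "z \<notin> G" for t z
    using det_nonzero_outside_gersh[of D z a \<Omega> E t] diag a that TDE by (auto simp: f_def G_def)
  have qG: "q \<notin> G" using q by (simp add: G_def)
  have nzD: "det (D q) \<noteq> 0" and nzT: "det (T q) \<noteq> 0"
    using fnz[OF _ q(1) qG, of 0] fnz[OF _ q(1) qG, of 1] by (simp_all add: f0 f1)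
  note holD = det_holomorphic[OF D] and holT = det_holomorphic[OF T]
  obtain W0 where W0: "open W0" "U \<subseteq> W0" "compact (closure W0)" "closure W0 \<subseteq> \<Omega>"
    using isolating_neighbourhood[OF \<Omega>(1) Gcl UG comp \<Omega>(1) U\<Omega>] by metis
  define Z where "Z = {p\<in>closure W0. det (D p) = 0} \<union> {p\<in>closure W0. det (T p) = 0}"
  have "finite Z" unfolding Z_def
    using holomorphic_finite_zeros_compact[OF holD \<Omega> W0(3,4) q(1) nzD]
      holomorphic_finite_zeros_compact[OF holT \<Omega> W0(3,4) q(1) nzT] by simp
  have "open (W0 - (Z - U))" using W0(1) \<open>finite Z\<close> by (intro open_Diff finite_imp_closed) auto
  moreover have "U \<subseteq> W0 - (Z - U)" using W0 by blast
  ultimately obtain W where W: "open W" "U \<subseteq> W" "compact (closure W)" "closure W \<subseteq> \<Omega>"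
      "closure W \<subseteq> W0 - (Z - U)" "frontier W \<inter> G = {}"
    using isolating_neighbourhood[OF \<Omega>(1) Gcl UG comp] by metis
  have WW0: "W \<subseteq> closure W0" "W \<inter> (Z - U) = {}" "W \<subseteq> \<Omega>"
    using W closure_subset by blast+
  have zT: "{p \<in> W. det (T p) = 0} = spectrum \<Omega> T \<inter> U"
    using WW0 W(2) by (auto simp: spectrum_def invertible_det_nz Z_def)
  have zD: "{p \<in> W. det (D p) = 0} = spectrum \<Omega> D \<inter> U"
    using WW0 W(2) by (auto simp: spectrum_def invertible_det_nz Z_def)
  show "finite (spectrum \<Omega> T \<inter> U)" "finite (spectrum \<Omega> D \<inter> U)"
    unfolding zT[symmetric] zD[symmetric]
    by (rule finite_subset[OF _ \<open>finite Z\<close>], use WW0 in \<open>auto simp: Z_def\<close>)+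
  have "zero_count (f 1) W = zero_count (f 0) W"
  proof (rule zero_count_homotopy[OF \<Omega> W(1,3,4)])
    have "continuous_on ({0..1} \<times> \<Omega>) (\<lambda>p::real \<times> complex. F (snd p) $ i $ j)"
      if "analytic_matrix_on F \<Omega>" for F :: "complex \<Rightarrow> complex ^ 'n ^ 'n" and i j
      by (rule continuous_on_compose2[OF analytic_matrix_entry_continuous[OF that]])
        (auto intro: continuous_intros)
    note entry = this[OF T] this[OF D]
    show "continuous_on ({0..1} \<times> \<Omega>) (\<lambda>p. f (fst p) (snd p))"
      unfolding f_def det_def
      by (simp, intro continuous_on_sum continuous_on_mult continuous_on_prod continuous_on_add
          continuous_on_diff continuous_on_scaleR continuous_on_const continuous_on_fst
          continuous_on_id entry)
    show "f t holomorphic_on \<Omega>" for t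
      unfolding f_def det_def
      by (simp add: scaleR_conv_of_real, intro holomorphic_intros analytic_matrix_entry_holomorphic T D)
    show "f t z \<noteq> 0" if "t \<in> {0..1}" "z \<in> frontier W" for t z
      using that W by (intro fnz) (auto simp: frontier_def)
    show "f t q \<noteq> 0" if "t \<in> {0..1}" for t by (rule fnz[OF that q(1) qG])
  qed (rule q(1))
  then have "int (eig_count \<Omega> T U) = int (eig_count \<Omega> D U)"
    using int_eig_count[OF \<Omega> T q(1) nzT zT] int_eig_count[OF \<Omega> D q(1) nzD zD]
    by (simp add: f0 f1)
  then show "eig_count \<Omega> T U = eig_count \<Omega> D U" by simp
qed

theorem theorem3p1:
  fixes \<Omega> :: "complex set"
    and T D E :: "complex \<Rightarrow> complex ^ 'n ^ 'n"
    and \<alpha> :: real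
  assumes "open \<Omega>" and "connected \<Omega>" and "\<Omega> \<noteq> {}" and "simply_connected \<Omega>"
    and "analytic_matrix_on T \<Omega>" and "regular_on T \<Omega>"
    and "analytic_matrix_on D \<Omega>" and "analytic_matrix_on E \<Omega>"
    and "\<forall>z\<in>\<Omega>. T z = D z + E z"
    and "\<forall>z\<in>\<Omega>. \<forall>i j. i \<noteq> j \<longrightarrow> D z $ i $ j = 0"
    and "0 \<le> \<alpha>" and "\<alpha> \<le> 1"
  shows "spectrum \<Omega> T \<subseteq> (\<Union>j. gersh_region \<Omega> D E \<alpha> j) \<and>
    (\<forall>U. U \<in> components (\<Union>j. gersh_region \<Omega> D E \<alpha> j) \<and> bounded U \<and> closure U \<subseteq> \<Omega> \<longrightarrow>
       finite (spectrum \<Omega> T \<inter> U) \<and> finite (spectrum \<Omega> D \<inter> U) \<and>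
       eig_count \<Omega> T U = eig_count \<Omega> D U \<and>
       (\<forall>m P. P \<subseteq> gersh_components \<Omega> D E \<alpha> \<and> finite P \<and> card P = m \<and> (\<forall>(j, C)\<in>P. C \<subseteq> U)
          \<longrightarrow> m \<le> eig_count \<Omega> T U))"
proof (intro conjI allI impI)
  note \<Omega> = assms(1,2) and T = assms(5) and D = assms(7) and E = assms(8) and a = assms(11,12)
  have TDE: "T z = D z + E z" if "z \<in> \<Omega>" for z using assms(9) that by blast
  have diag: "D z $ i $ j = 0" if "z \<in> \<Omega>" "i \<noteq> j" for z i j using assms(10) that by blast
  show "spectrum \<Omega> T \<subseteq> (\<Union>j. gersh_region \<Omega> D E \<alpha> j)"
  proof
    fix z assume z: "z \<in> spectrum \<Omega> T"
    then have "z \<in> \<Omega>" "det (D z + 1 *\<^sub>R E z) = 0"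
      using TDE by (auto simp: spectrum_def invertible_det_nz)
    then show "z \<in> (\<Union>j. gersh_region \<Omega> D E \<alpha> j)"
      using det_nonzero_outside_gersh[of D z \<alpha> \<Omega> E 1] diag a by fastforce
  qed
  fix U assume "U \<in> components (\<Union>j. gersh_region \<Omega> D E \<alpha> j) \<and> bounded U \<and> closure U \<subseteq> \<Omega>"
  then have U: "U \<in> components (\<Union>j. gersh_region \<Omega> D E \<alpha> j)" "bounded U" "closure U \<subseteq> \<Omega>"
    by auto
  have "(\<Union>j. gersh_region \<Omega> D E \<alpha> j) \<subseteq> \<Omega>" by (auto simp: gersh_region_def)
  then obtain q where q: "q \<in> \<Omega>" "q \<notin> (\<Union>j. gersh_region \<Omega> D E \<alpha> j)"
    using component_outside_point[OF \<Omega> _ U] by metis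
  note agree = eig_counts_agree[OF \<Omega> T D E TDE diag a U q]
  show "finite (spectrum \<Omega> T \<inter> U)" "finite (spectrum \<Omega> D \<inter> U)"
    "eig_count \<Omega> T U = eig_count \<Omega> D U"
    using agree by auto
  fix m P
  assume P: "P \<subseteq> gersh_components \<Omega> D E \<alpha> \<and> finite P \<and> card P = m \<and> (\<forall>(j, C)\<in>P. C \<subseteq> U)"
  have "det (D q) \<noteq> 0"
    using det_nonzero_outside_gersh[of D q \<alpha> \<Omega> E 0] diag a q by auto
  then have "card P \<le> eig_count \<Omega> D U"
    using P by (intro card_gersh_components_le_diagonal_eig_count[OF \<Omega> D E diag a q(1) _ U(2,3) agree(2)]) auto
  then show "m \<le> eig_count \<Omega> T U" using P agree(3) by simp
qed

end
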